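(* Let $n \geq 2$, $p \geq 1$, and let $G_1,\ldots,G_n$ be vertex-disjoint graphs such that for each $i\in[n]$, $K_i=\{u_{i,1},\ldots,u_{i,p}\}$ is a clique in $G_i$. Let $G$ be the graph obtained from the disjoint union of $G_1,\ldots,G_n$ by identifying $u_{1,q},\ldots,u_{n,q}$ as a single vertex $u_q$ for each $q\in[p]$. Then for every integer $m\geq p$, $$P_{DP}(G,m) \leq \frac{\prod_{i=1}^{n} P_{DP}'(G_i,K_i,m)}{\left(\prod_{i=0}^{p-1}(m-i)\right)^{n-1}}.$$
   Context: All graphs are finite and simple; $[m]=\{1,\ldots,m\}$. A cover of a graph $G$ is a pair $\mathcal{H}=(L,H)$ where $H$ is a graph and $L:V(G)\to\mathcal{P}(V(H))$ satisfies: (1) $\{L(u):u\in V(G)\}$ is a partition of $V(H)$ into $|V(G)|$ parts; (2) $H[L(u)]$ is complete for each $u$; (3) if $E_H(L(u),L(v))$ is nonempty then $u=v$ or $uv\in E(G)$; (4) if $uv\in E(G)$ then $E_H(L(u),L(v))$ is a (possibly empty) matching. $\mathcal{H}$ is $m$-fold if $|L(u)|=m$ for all $u$, and full if moreover $E_H(L(u),L(v))$ is a perfect matching for every $uv\in E(G)$. An $m$-fold cover $\mathcal{H}=(L,H)$ has a canonical labeling if the vertices of $H$ can be named so that $L(u)=\{(u,j):j\in[m]\}$ for each $u$ and $(u,j)(v,j)\in E(H)$ for all $j\in[m]$ whenever $uv\in E(G)$. An $\mathcal{H}$-coloring of $G$ is an independent set of $H$ of size $|V(G)|$; $P_{DP}(G,\mathcal{H})$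 is the number of $\mathcal{H}$-colorings, and $P_{DP}(G,m)$ is the minimum of $P_{DP}(G,\mathcal{H})$ over all $m$-fold covers of $G$. For a clique $K$ in $G$, the subcover of $\mathcal{H}$ induced by $K$ is $\mathcal{H}_K=(L|_K, H[\bigcup_{u\in K}L(u)])$, an $m$-fold cover of $G[K]$. An $m$-fold cover $\mathcal{H}$ of $G$ is conducive to $K$ if $\mathcal{H}$ is full and $\mathcal{H}_K$ admits a canonical labeling. The $K$-canonical DP color function $P_{DP}'(G,K,m)$ is the minimum of $P_{DP}(G,\mathcal{H})$ over all $m$-fold covers $\mathcal{H}$ of $G$ conducive to $K$. *)

theory Defs
  imports Complex_Main "HOL-Library.Ramsey" "HOL-Library.Disjoint_Sets"
begin

datatype 'a graph = Graph (verts: "'a set") (edges: "'a set set")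

definition simple_graph :: "'a graph \<Rightarrow> bool" where
  "simple_graph G \<longleftrightarrow> finite (verts G) \<and> edges G \<subseteq> nsets (verts G) 2"

definition induced :: "'a graph \<Rightarrow> 'a set \<Rightarrow> 'a graph" where
  "induced G S = Graph (verts G \<inter> S) {e \<in> edges G. e \<subseteq> S}"

definition edges_between :: "'a graph \<Rightarrow> 'a set \<Rightarrow> 'a set \<Rightarrow> 'a set set" where
  "edges_between G A B = {e \<in> edges G. \<exists>x\<in>A. \<exists>y\<in>B. e = {x, y}}"

definition is_clique :: "'a graph \<Rightarrow> 'a set \<Rightarrow> bool" where
  "is_clique G K \<longleftrightarrow> K \<subseteq> verts G \<and> clique K (edges G)"

definition quotient_graph :: "'a graph \<Rightarrow> ('a \<times> 'a) set \<Rightarrow> 'a set graph" where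
  "quotient_graph G r = Graph (verts G // r) ((\<lambda>e. (\<lambda>x. r `` {x}) ` e) ` edges G)"

text \<open>Only meant for families of vertex-disjoint graphs.\<close>

definition graph_union :: "'i set \<Rightarrow> ('i \<Rightarrow> 'a graph) \<Rightarrow> 'a graph" where
  "graph_union I Gs = Graph (\<Union>i\<in>I. verts (Gs i)) (\<Union>i\<in>I. edges (Gs i))"

definition ident_rel :: "'a set \<Rightarrow> nat \<Rightarrow> nat \<Rightarrow> (nat \<Rightarrow> nat \<Rightarrow> 'a) \<Rightarrow> ('a \<times> 'a) set" where
  "ident_rel V n p u = {(x, y) \<in> V \<times> V. x = y \<or>
     (\<exists>q\<in>{1..p}. \<exists>i\<in>{1..n}. \<exists>j\<in>{1..n}. x = u i q \<and> y = u j q)}"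

definition amalgamation ::
  "nat \<Rightarrow> nat \<Rightarrow> (nat \<Rightarrow> 'a graph) \<Rightarrow> (nat \<Rightarrow> nat \<Rightarrow> 'a) \<Rightarrow> 'a set graph" where
  "amalgamation n p Gs u =
     (let U = graph_union {1..n} Gs in quotient_graph U (ident_rel (verts U) n p u))"

text \<open>The cardinality condition says that the \<^term>\<open>L u\<close> are distinct for distinct \<^term>\<open>u\<close>.\<close>

definition is_cover :: "'a graph \<Rightarrow> ('a \<Rightarrow> 'h set) \<Rightarrow> 'h graph \<Rightarrow> bool" where
  "is_cover G L H \<longleftrightarrow>
     simple_graph H \<and>
     partition_on (verts H) (L ` verts G) \<and> card (L ` verts G) = card (verts G) \<and>
     (\<forall>u\<in>verts G. clique (L u) (edges H)) \<and>
     (\<forall>u\<in>verts G. \<forall>v\<in>verts G.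
        edges_between H (L u) (L v) \<noteq> {} \<longrightarrow> u = v \<or> {u, v} \<in> edges G) \<and>
     (\<forall>u v. {u, v} \<in> edges G \<longrightarrow> disjoint (edges_between H (L u) (L v)))"

definition fold_cover :: "'a graph \<Rightarrow> nat \<Rightarrow> ('a \<Rightarrow> 'h set) \<Rightarrow> 'h graph \<Rightarrow> bool" where
  "fold_cover G m L H \<longleftrightarrow> is_cover G L H \<and> (\<forall>u\<in>verts G. card (L u) = m)"

text \<open>The matchings of a cover are already required to be matchings by \<^const>\<open>is_cover\<close>;
  fullness adds that they saturate both parts.\<close>

definition full_cover :: "'a graph \<Rightarrow> nat \<Rightarrow> ('a \<Rightarrow> 'h set) \<Rightarrow> 'h graph \<Rightarrow> bool" where
  "full_cover G m L H \<longleftrightarrow> fold_cover G m L H \<and>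
     (\<forall>u v. {u, v} \<in> edges G \<longrightarrow> \<Union> (edges_between H (L u) (L v)) = L u \<union> L v)"

text \<open>The function \<^term>\<open>name\<close> says which vertex of \<^term>\<open>H\<close> is called \<^term>\<open>(u, j)\<close>.\<close>

definition canonical_labeling :: "'a graph \<Rightarrow> nat \<Rightarrow> ('a \<Rightarrow> 'h set) \<Rightarrow> 'h graph \<Rightarrow> bool" where
  "canonical_labeling G m L H \<longleftrightarrow>
     (\<exists>name :: 'a \<times> nat \<Rightarrow> 'h.
        bij_betw name (verts G \<times> {1..m}) (verts H) \<and>
        (\<forall>u\<in>verts G. L u = {name (u, j) | j. j \<in> {1..m}}) \<and>
        (\<forall>u v. {u, v} \<in> edges G \<longrightarrow>
           (\<forall>j\<in>{1..m}. {name (u, j), name (v, j)} \<in> edges H)))"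

text \<open>The subcover induced by \<^term>\<open>K\<close> has the list assignment \<^term>\<open>restrict L K\<close>
  and the following cover graph.\<close>

definition subcover_graph :: "('a \<Rightarrow> 'h set) \<Rightarrow> 'h graph \<Rightarrow> 'a set \<Rightarrow> 'h graph" where
  "subcover_graph L H K = induced H (\<Union>u\<in>K. L u)"

definition conducive :: "'a graph \<Rightarrow> 'a set \<Rightarrow> nat \<Rightarrow> ('a \<Rightarrow> 'h set) \<Rightarrow> 'h graph \<Rightarrow> bool" where
  "conducive G K m L H \<longleftrightarrow> full_cover G m L H \<and>
     canonical_labeling (induced G K) m (restrict L K) (subcover_graph L H K)"

definition cover_coloring :: "'a graph \<Rightarrow> 'h graph \<Rightarrow> 'h set \<Rightarrow> bool" where
  "cover_coloring G H I \<longleftrightarrow> I \<subseteq> verts H \<and> indep I (edges H) \<and> card I = card (verts G)"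

definition num_colorings :: "'a graph \<Rightarrow> 'h graph \<Rightarrow> nat" where
  "num_colorings G H = card {I. cover_coloring G H I}"

text \<open>Cover graphs are finite, so up to isomorphism their vertices are natural numbers. The minima
  therefore range over covers with \<^typ>\<open>nat\<close> vertices; the lemmas \<open>P_DP_le\<close> and \<open>P_DP_can_le\<close> below
  confirm that nothing is lost. On \<^typ>\<open>nat\<close>, the infimum of a nonempty set is its minimum,
  and \<open>conducive_cover_exists\<close> gives nonemptiness for \<^term>\<open>m \<ge> (1 :: nat)\<close>.\<close>

definition P_DP :: "'a graph \<Rightarrow> nat \<Rightarrow> nat" where
  "P_DP G m = Inf {num_colorings G H | L (H :: nat graph). fold_cover G m L H}"

definition P_DP_can :: "'a graph \<Rightarrow> 'a set \<Rightarrow> nat \<Rightarrow> nat" where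
  "P_DP_can G K m = Inf {num_colorings G H | L (H :: nat graph). conducive G K m L H}"

lemma simple_graph_edgeD:
  assumes "simple_graph G" "{u, v} \<in> edges G"
  shows "u \<in> verts G" "v \<in> verts G" "u \<noteq> v"
  using assms by (auto simp: simple_graph_def nsets_def)

context
  fixes G :: "'a graph" and L :: "'a \<Rightarrow> 'h set" and H :: "'h graph" and g :: "'h \<Rightarrow> 'k"
    and L' :: "'a \<Rightarrow> 'k set" and H' :: "'k graph"
  assumes inj: "inj_on g (verts H)" and G: "simple_graph G"
  assumes L': "L' = (\<lambda>u. g ` L u)" and H': "H' = Graph (g ` verts H) ((`) g ` edges H)"
begin

lemma transfer_edge_iff:
  assumes "simple_graph H" "S \<subseteq> verts H"
  shows "g ` S \<in> edges H' \<longleftrightarrow> S \<in> edges H"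
proof
  assume "g ` S \<in> edges H'"
  then obtain e where e: "e \<in> edges H" "g ` S = g ` e" by (auto simp: H')
  then have "e \<subseteq> verts H" using assms(1) by (auto simp: simple_graph_def nsets_def)
  then have "S = e" using e(2) inj assms(2) by (simp add: inj_on_image_eq_iff)
  then show "S \<in> edges H" using e by simp
qed (auto simp: H')

lemma transfer_pair_iff:
  assumes "simple_graph H" "x \<in> verts H" "y \<in> verts H"
  shows "{g x, g y} \<in> edges H' \<longleftrightarrow> {x, y} \<in> edges H"
  using transfer_edge_iff[of "{x, y}"] assms by simp

lemma transfer_edges_between:
  assumes "simple_graph H" "A \<subseteq> verts H" "B \<subseteq> verts H"
  shows "edges_between H' (g ` A) (g ` B) = (`) g ` edges_between H A B"
proof (intro set_eqI iffI)
  fix e assume "e \<in> edges_between H' (g ` A) (g ` B)"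
  then obtain x y where xy: "x \<in> A" "y \<in> B" "e = {g x, g y}" "e \<in> edges H'"
    by (auto simp: edges_between_def)
  then have "{x, y} \<in> edges H" using transfer_pair_iff[of x y] assms by auto
  then have "{x, y} \<in> edges_between H A B" using xy by (auto simp: edges_between_def)
  then show "e \<in> (`) g ` edges_between H A B" using xy(3) by (auto intro!: image_eqI[of _ _ "{x, y}"])
next
  fix e assume "e \<in> (`) g ` edges_between H A B"
  then show "e \<in> edges_between H' (g ` A) (g ` B)" by (auto simp: edges_between_def H')
qed

lemma transfer_simple_graph:
  assumes "simple_graph H"
  shows "simple_graph H'"
  unfolding simple_graph_def
proof (intro conjI subsetI)
  show "finite (verts H')" using assms by (simp add: H' simple_graph_def)
  fix e assume "e \<in> edges H'"
  then obtain d where d: "d \<in> edges H" "e = g ` d" by (auto simp: H')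
  then have "d \<subseteq> verts H" "finite d" "card d = 2"
    using assms by (auto simp: simple_graph_def nsets_def)
  then show "e \<in> nsets (verts H') 2"
    using d(2) inj by (auto simp: nsets_def H' card_image inj_on_subset)
qed

lemma fold_coverD:
  assumes "fold_cover G m L H"
  shows "simple_graph H" "\<And>u. u \<in> verts G \<Longrightarrow> L u \<subseteq> verts H"
  using assms by (auto simp: fold_cover_def is_cover_def partition_on_def)

lemma transfer_fold_cover:
  assumes "fold_cover G m L H"
  shows "fold_cover G m L' H'"
proof -
  note H = fold_coverD(1)[OF assms] and Lsub = fold_coverD(2)[OF assms]
  have cov: "is_cover G L H" and m: "\<And>u. u \<in> verts G \<Longrightarrow> card (L u) = m"
    using assms by (auto simp: fold_cover_def)
  have L'img: "L' ` verts G = (`) g ` (L ` verts G)" by (auto simp: L')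
  have "inj_on ((`) g) (Pow (verts H))" using inj by (rule inj_on_image_Pow)
  then have inj': "inj_on ((`) g) (L ` verts G)" using Lsub by (auto intro: inj_on_subset)
  have part: "partition_on (verts H) (L ` verts G)" using cov by (simp add: is_cover_def)
  have "partition_on (verts H') (L' ` verts G)"
    unfolding partition_on_def
  proof (intro conjI)
    have "\<Union> (L ` verts G) = verts H" using part by (simp add: partition_on_def)
    moreover have "\<Union> (L' ` verts G) = g ` \<Union> (L ` verts G)" by (auto simp: L')
    ultimately show "\<Union> (L' ` verts G) = verts H'" by (simp add: H')
    have "inj_on g (\<Union> (L ` verts G))" using inj \<open>\<Union> (L ` verts G) = verts H\<close> by simp
    then show "disjoint (L' ` verts G)"
      unfolding L'img using part by (intro disjoint_image) (simp_all add: partition_on_def)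
    show "{} \<notin> L' ` verts G" using part by (auto simp: L' partition_on_def)
  qed
  moreover have "card (L' ` verts G) = card (verts G)"
    unfolding L'img using card_image[OF inj'] cov by (simp add: is_cover_def)
  moreover have "clique (L' u) (edges H')" if "u \<in> verts G" for u
  proof -
    have "clique (L u) (edges H)" using cov that by (simp add: is_cover_def)
    then have "\<And>x y. x \<in> L u \<Longrightarrow> y \<in> L u \<Longrightarrow> x \<noteq> y \<Longrightarrow> {g x, g y} \<in> edges H'"
      using transfer_pair_iff[OF H] Lsub[OF that] unfolding clique_def by blast
    then show ?thesis by (force simp: L' clique_def)
  qed
  moreover have "u = v \<or> {u, v} \<in> edges G"
    if "u \<in> verts G" "v \<in> verts G" "edges_between H' (L' u) (L' v) \<noteq> {}" for u v
    using that cov transfer_edges_between[OF H Lsub Lsub, of u v]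
    by (auto simp: L' is_cover_def)
  moreover have "disjoint (edges_between H' (L' u) (L' v))" if "{u, v} \<in> edges G" for u v
  proof -
    have uv: "u \<in> verts G" "v \<in> verts G" using simple_graph_edgeD[OF G that] by auto
    have "\<Union> (edges_between H (L u) (L v)) \<subseteq> verts H"
      using H by (auto simp: edges_between_def simple_graph_def nsets_def)
    then have "inj_on g (\<Union> (edges_between H (L u) (L v)))" using inj inj_on_subset by blast
    then show ?thesis
      using transfer_edges_between[OF H Lsub Lsub, OF uv] cov that
      by (auto simp: L' is_cover_def intro: disjoint_image)
  qed
  moreover have "card (L' u) = m" if "u \<in> verts G" for u
    using card_image[OF inj_on_subset[OF inj Lsub[OF that]]] m[OF that] by (simp add: L')
  ultimately show ?thesis using transfer_simple_graph[OF H] by (simp add: fold_cover_def is_cover_def)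
qed

lemma transfer_full_cover:
  assumes "full_cover G m L H"
  shows "full_cover G m L' H'"
proof -
  have fc: "fold_cover G m L H" using assms by (simp add: full_cover_def)
  note H = fold_coverD(1)[OF fc] and Lsub = fold_coverD(2)[OF fc]
  have "\<Union> (edges_between H' (L' u) (L' v)) = L' u \<union> L' v" if "{u, v} \<in> edges G" for u v
  proof -
    have uv: "u \<in> verts G" "v \<in> verts G" using simple_graph_edgeD[OF G that] by auto
    have "\<Union> (edges_between H' (L' u) (L' v)) = g ` (\<Union> (edges_between H (L u) (L v)))"
      using transfer_edges_between[OF H Lsub Lsub, OF uv] by (auto simp: L')
    also have "\<dots> = g ` (L u \<union> L v)" using assms that by (simp add: full_cover_def)
    finally show ?thesis by (auto simp: L')
  qed
  then show ?thesis using transfer_fold_cover[OF fc] by (simp add: full_cover_def)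
qed

lemma transfer_conducive:
  assumes "conducive G K m L H" "K \<subseteq> verts G"
  shows "conducive G K m L' H'"
proof -
  have full: "full_cover G m L H" using assms by (simp add: conducive_def)
  then have fc: "fold_cover G m L H" by (simp add: full_cover_def)
  note H = fold_coverD(1)[OF fc] and Lsub = fold_coverD(2)[OF fc]
  obtain name :: "'a \<times> nat \<Rightarrow> 'h" where name:
    "bij_betw name (verts (induced G K) \<times> {1..m}) (verts (subcover_graph L H K))"
    "\<forall>u\<in>verts (induced G K). restrict L K u = {name (u, j) | j. j \<in> {1..m}}"
    "\<forall>u v. {u, v} \<in> edges (induced G K) \<longrightarrow>
       (\<forall>j\<in>{1..m}. {name (u, j), name (v, j)} \<in> edges (subcover_graph L H K))"
    using assms(1)[unfolded conducive_def canonical_labeling_def, THEN conjunct2]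
    by (elim exE conjE) (rule that)
  have LK: "(\<Union>u\<in>K. L u) \<subseteq> verts H" using Lsub assms(2) by auto
  have v: "verts (subcover_graph L H K) = (\<Union>u\<in>K. L u)"
    "verts (subcover_graph L' H' K) = g ` (\<Union>u\<in>K. L u)"
    using LK by (auto simp: subcover_graph_def induced_def L' H')
  have "canonical_labeling (induced G K) m (restrict L' K) (subcover_graph L' H' K)"
    unfolding canonical_labeling_def
  proof (intro exI[of _ "g \<circ> name"] conjI ballI allI impI)
    have "bij_betw g (\<Union>u\<in>K. L u) (g ` (\<Union>u\<in>K. L u))"
      using inj LK by (meson inj_on_imp_bij_betw inj_on_subset)
    then show "bij_betw (g \<circ> name) (verts (induced G K) \<times> {1..m}) (verts (subcover_graph L' H' K))"
      using name(1) bij_betw_trans unfolding v by blast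
    fix u assume u: "u \<in> verts (induced G K)"
    then have "u \<in> K" by (simp add: induced_def)
    then show "restrict L' K u = {(g \<circ> name) (u, j) | j. j \<in> {1..m}}"
      using bspec[OF name(2) u] by (auto simp: L')
  next
    fix u v j assume "{u, v} \<in> edges (induced G K)" "j \<in> {1..m}"
    from name(3)[rule_format, OF this]
    have e: "{name (u, j), name (v, j)} \<in> edges H" "{name (u, j), name (v, j)} \<subseteq> (\<Union>u\<in>K. L u)"
      by (auto simp: subcover_graph_def induced_def)
    then have "{g (name (u, j)), g (name (v, j))} \<in> edges H'"
      using transfer_pair_iff[OF H, of "name (u, j)" "name (v, j)"] LK by (simp add: subset_iff)
    moreover have "{g (name (u, j)), g (name (v, j))} \<subseteq> g ` (\<Union>u\<in>K. L u)"
      using e(2) by (simp add: image_eqI)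
    moreover have "g ` (\<Union>u\<in>K. L u) = (\<Union>u\<in>K. L' u)" by (simp add: L' image_UN)
    ultimately show "{(g \<circ> name) (u, j), (g \<circ> name) (v, j)} \<in> edges (subcover_graph L' H' K)"
      by (simp add: subcover_graph_def induced_def)
  qed
  then show ?thesis using transfer_full_cover[OF full] by (simp add: conducive_def)
qed

lemma transfer_num_colorings:
  assumes H: "simple_graph H"
  shows "num_colorings G H' = num_colorings G H"
proof -
  have indep: "indep (g ` I) (edges H') \<longleftrightarrow> indep I (edges H)" if "I \<subseteq> verts H" for I
  proof -
    have "indep (g ` I) (edges H') \<longleftrightarrow> (\<forall>x\<in>I. \<forall>y\<in>I. g x \<noteq> g y \<longrightarrow> {g x, g y} \<notin> edges H')"
      by (auto simp: indep_def)
    also have "\<dots> \<longleftrightarrow> indep I (edges H)"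
      unfolding indep_def using transfer_pair_iff[OF H] that inj
      by (smt (verit, best) inj_on_eq_iff subset_eq)
    finally show ?thesis .
  qed
  have card: "card (g ` I) = card I" if "I \<subseteq> verts H" for I
    using card_image inj inj_on_subset that by blast
  have "{I. cover_coloring G H' I} = (`) g ` {I. cover_coloring G H I}"
  proof (intro set_eqI iffI)
    fix J assume "J \<in> {I. cover_coloring G H' I}"
    then have J: "cover_coloring G H' J" by simp
    then have "J \<subseteq> g ` verts H" by (simp add: cover_coloring_def H')
    then obtain I where I: "I \<subseteq> verts H" "J = g ` I" by (auto simp: subset_image_iff)
    then show "J \<in> (`) g ` {I. cover_coloring G H I}"
      using J indep card by (auto simp: cover_coloring_def)
  next
    fix J assume "J \<in> (`) g ` {I. cover_coloring G H I}"
    then obtain I where I: "J = g ` I" "cover_coloring G H I" by auto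
    then show "J \<in> {I. cover_coloring G H' I}"
      using indep[of I] card[of I] by (auto simp: cover_coloring_def H')
  qed
  moreover have "inj_on ((`) g) {I. cover_coloring G H I}"
    by (rule inj_on_subset[OF inj_on_image_Pow[OF inj]]) (auto simp: cover_coloring_def)
  ultimately show ?thesis by (simp add: num_colorings_def card_image)
qed

end

lemma P_DP_le:
  fixes H :: "'h graph"
  assumes "simple_graph G" "fold_cover G m L H"
  shows "P_DP G m \<le> num_colorings G H"
proof -
  have H: "simple_graph H" using assms(2) by (simp add: fold_cover_def is_cover_def)
  then obtain g :: "'h \<Rightarrow> nat" where g: "inj_on g (verts H)"
    using finite_imp_inj_to_nat_seg by (metis simple_graph_def)
  let ?H = "Graph (g ` verts H) ((`) g ` edges H)"
  have "num_colorings G ?H \<in> {num_colorings G H | L (H :: nat graph). fold_cover G m L H}"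
    using transfer_fold_cover[OF g assms(1) refl refl assms(2)] by blast
  then have "P_DP G m \<le> num_colorings G ?H" unfolding P_DP_def by (rule cInf_lower) simp
  then show ?thesis using transfer_num_colorings[OF g assms(1) refl refl H] by simp
qed

lemma P_DP_can_le:
  fixes H :: "'h graph"
  assumes "simple_graph G" "K \<subseteq> verts G" "conducive G K m L H"
  shows "P_DP_can G K m \<le> num_colorings G H"
proof -
  have H: "simple_graph H"
    using assms(3) by (simp add: conducive_def full_cover_def fold_cover_def is_cover_def)
  then obtain g :: "'h \<Rightarrow> nat" where g: "inj_on g (verts H)"
    using finite_imp_inj_to_nat_seg by (metis simple_graph_def)
  let ?H = "Graph (g ` verts H) ((`) g ` edges H)"
  have "num_colorings G ?H \<in> {num_colorings G H | L (H :: nat graph). conducive G K m L H}"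
    using transfer_conducive[OF g assms(1) refl refl assms(3,2)] by blast
  then have "P_DP_can G K m \<le> num_colorings G ?H" unfolding P_DP_can_def by (rule cInf_lower) simp
  then show ?thesis using transfer_num_colorings[OF g assms(1) refl refl H] by simp
qed

lemma conducive_cover_exists:
  fixes G :: "'a graph"
  assumes G: "simple_graph G" and K: "K \<subseteq> verts G" and m: "m \<ge> 1"
  shows "\<exists>L (H :: nat graph). conducive G K m L H"
proof -
  define L where "L = (\<lambda>u :: 'a. {u} \<times> {1..m})"
  define E1 where "E1 = {{(u, i), (u, j)} | u i j. u \<in> verts G \<and> i \<in> {1..m} \<and> j \<in> {1..m} \<and> i \<noteq> j}"
  define E2 where "E2 = {{(u, j), (v, j)} | u v j. {u, v} \<in> edges G \<and> j \<in> {1..m}}"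
  define H where "H = Graph (verts G \<times> {1..m}) (E1 \<union> E2)"
  have "finite (verts G)" using G by (simp add: simple_graph_def)
  have E1: "e \<in> nsets (verts H) 2" if "e \<in> E1" for e
    using that by (auto simp: E1_def H_def nsets_def)
  have E2: "e \<in> nsets (verts H) 2" if "e \<in> E2" for e
    using that simple_graph_edgeD[OF G] by (auto simp: E2_def H_def nsets_def)
  have H: "simple_graph H"
    using E1 E2 \<open>finite (verts G)\<close> by (auto simp: simple_graph_def H_def)
  have between: "edges_between H (L u) (L v) = {{(u, j), (v, j)} | j. j \<in> {1..m}}"
    if uv: "{u, v} \<in> edges G" for u v
  proof (intro set_eqI iffI)
    note uv' = simple_graph_edgeD[OF G uv]
    fix e assume "e \<in> edges_between H (L u) (L v)"
    then obtain i j where ij: "e = {(u, i), (v, j)}" "i \<in> {1..m}" "j \<in> {1..m}" "e \<in> E1 \<union> E2"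
      by (auto simp: edges_between_def L_def H_def)
    then have "i = j" using uv' by (auto simp: E1_def E2_def doubleton_eq_iff)
    then show "e \<in> {{(u, j), (v, j)} | j. j \<in> {1..m}}" using ij by blast
  next
    fix e assume "e \<in> {{(u, j), (v, j)} | j. j \<in> {1..m}}"
    then obtain j where j: "e = {(u, j), (v, j)}" "j \<in> {1..m}" by blast
    then have "e \<in> E2" using uv unfolding E2_def by blast
    moreover have "(u, j) \<in> L u" "(v, j) \<in> L v" using j(2) by (auto simp: L_def)
    ultimately show "e \<in> edges_between H (L u) (L v)"
      using j(1) unfolding edges_between_def H_def graph.sel by blast
  qed
  have mem1: "(u, 1) \<in> L v \<longleftrightarrow> u = v" for u v using m by (simp add: L_def)
  have injL: "inj_on L (verts G)" using mem1 by (metis inj_onI)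
  have "is_cover G L H"
    unfolding is_cover_def
  proof (intro conjI ballI allI impI)
    show "partition_on (verts H) (L ` verts G)"
      unfolding partition_on_def
    proof (intro conjI)
      show "\<Union> (L ` verts G) = verts H" by (auto simp: L_def H_def)
      show "disjoint (L ` verts G)" by (auto simp: disjoint_def L_def)
      show "{} \<notin> L ` verts G" using mem1 by blast
    qed
    show "card (L ` verts G) = card (verts G)" using injL by (rule card_image)
    fix u assume u: "u \<in> verts G"
    have "{(u, i), (u, j)} \<in> edges H" if "i \<in> {1..m}" "j \<in> {1..m}" "i \<noteq> j" for i j
      using that u unfolding H_def E1_def graph.sel by blast
    then show "clique (L u) (edges H)" by (auto simp: clique_def L_def)
  next
    fix u v assume "u \<in> verts G" "v \<in> verts G" "edges_between H (L u) (L v) \<noteq> {}"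
    then obtain i j where "{(u, i), (v, j)} \<in> E1 \<union> E2"
      by (auto simp: edges_between_def L_def H_def)
    then show "u = v \<or> {u, v} \<in> edges G"
      by (auto simp: E1_def E2_def doubleton_eq_iff insert_commute)
  next
    fix u v assume uv: "{u, v} \<in> edges G"
    show "disjoint (edges_between H (L u) (L v))"
      unfolding between[OF uv] using simple_graph_edgeD[OF G uv] by (auto simp: disjoint_def)
  qed (rule H)
  moreover have "card (L u) = m" for u by (simp add: L_def card_cartesian_product)
  ultimately have fold: "fold_cover G m L H" by (simp add: fold_cover_def)
  have full: "full_cover G m L H"
    unfolding full_cover_def
  proof (intro conjI allI impI)
    fix u v assume "{u, v} \<in> edges G"
    moreover have "\<Union> {{(u, j), (v, j)} | j. j \<in> {1..m}} = L u \<union> L v"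
      unfolding L_def by blast
    ultimately show "\<Union> (edges_between H (L u) (L v)) = L u \<union> L v" using between by simp
  qed (rule fold)
  have vK: "verts (induced G K) = K" using K by (auto simp: induced_def)
  have vS: "verts (subcover_graph L H K) = K \<times> {1..m}"
    using K by (auto simp: subcover_graph_def induced_def L_def H_def)
  have "{(u, j), (v, j)} \<in> edges (subcover_graph L H K)"
    if "{u, v} \<in> edges (induced G K)" "j \<in> {1..m}" for u v j
  proof -
    have uv: "{u, v} \<in> edges G" "u \<in> K" "v \<in> K" using that by (auto simp: induced_def)
    then have "{(u, j), (v, j)} \<in> E2" using that(2) unfolding E2_def by blast
    then show ?thesis using uv that(2) by (auto simp: subcover_graph_def induced_def H_def L_def)
  qed
  then have "canonical_labeling (induced G K) m (restrict L K) (subcover_graph L H K)"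
    unfolding canonical_labeling_def vK vS
    by (intro exI[of _ id] conjI) (auto simp: L_def)
  then have con: "conducive G K m L H" using full by (simp add: conducive_def)
  obtain g :: "'a \<times> nat \<Rightarrow> nat" where g: "inj_on g (verts H)"
    using H finite_imp_inj_to_nat_seg by (metis simple_graph_def)
  show ?thesis using transfer_conducive[OF g G refl refl con K] by blast
qed

context
  fixes n p :: nat and Gs :: "nat \<Rightarrow> 'a graph" and u :: "nat \<Rightarrow> nat \<Rightarrow> 'a"
  assumes simple: "\<And>i. i \<in> {1..n} \<Longrightarrow> simple_graph (Gs i)"
    and disj: "disjoint_family_on (\<lambda>i. verts (Gs i)) {1..n}"
    and inj: "\<And>i. i \<in> {1..n} \<Longrightarrow> inj_on (u i) {1..p}"
    and u_verts: "\<And>i. i \<in> {1..n} \<Longrightarrow> u i ` {1..p} \<subseteq> verts (Gs i)"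
begin

lemma u_in_vertsD:
  assumes "i \<in> {1..n}" "j \<in> {1..n}" "q \<in> {1..p}" "u i q \<in> verts (Gs j)"
  shows "i = j"
proof -
  have "u i q \<in> verts (Gs i)" using u_verts assms by blast
  then show ?thesis using disj assms unfolding disjoint_family_on_def by blast
qed

lemma u_eqD:
  assumes "i \<in> {1..n}" "j \<in> {1..n}" "q \<in> {1..p}" "q' \<in> {1..p}" "u i q = u j q'"
  shows "i = j" "q = q'"
proof -
  have "u j q' \<in> verts (Gs j)" using u_verts assms by blast
  then show "i = j" using u_in_vertsD[of i j q] assms by simp
  then show "q = q'" using inj[of i] assms by (simp add: inj_on_eq_iff)
qed

lemma equiv_ident_rel:
  "equiv (verts (graph_union {1..n} Gs)) (ident_rel (verts (graph_union {1..n} Gs)) n p u)"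
  (is "equiv ?V ?r")
proof (rule equivI)
  show "?r \<subseteq> ?V \<times> ?V" by (auto simp: ident_rel_def)
  show "refl_on ?V ?r" by (auto simp: ident_rel_def refl_on_def)
  show "sym ?r" by (rule symI) (unfold ident_rel_def, blast)
  show "trans ?r"
  proof (rule transI)
    fix x y z assume xy: "(x, y) \<in> ?r" and yz: "(y, z) \<in> ?r"
    show "(x, z) \<in> ?r"
    proof (cases "x = y \<or> y = z")
      case True
      then show ?thesis using xy yz by blast
    next
      case False
      then obtain q i j where 1: "q \<in> {1..p}" "i \<in> {1..n}" "j \<in> {1..n}" "x = u i q" "y = u j q"
        using xy unfolding ident_rel_def by blast
      obtain q' i' j' where 2: "q' \<in> {1..p}" "i' \<in> {1..n}" "j' \<in> {1..n}" "y = u i' q'" "z = u j' q'"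
        using False yz unfolding ident_rel_def by blast
      have "q' = q" using u_eqD(2)[of j i' q q'] 1 2 by simp
      moreover have "x \<in> ?V" "z \<in> ?V" using xy yz by (auto simp: ident_rel_def)
      ultimately show ?thesis using 1 2 unfolding ident_rel_def by blast
    qed
  qed
qed

lemma simple_graph_amalgamation: "simple_graph (amalgamation n p Gs u)"
proof -
  define U where "U = graph_union {1..n} Gs"
  define r where "r = ident_rel (verts U) n p u"
  have eq: "equiv (verts U) r" unfolding U_def r_def by (rule equiv_ident_rel)
  have "finite (verts U)" using simple by (simp add: U_def graph_union_def simple_graph_def)
  then have "finite (verts U // r)"
    using eq by (meson equiv_type finite_quotient)
  moreover have "(\<lambda>x. r `` {x}) ` e \<in> nsets (verts U // r) 2" if e: "e \<in> edges U" for e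
  proof -
    obtain i where i: "i \<in> {1..n}" "e \<in> edges (Gs i)"
      using e by (auto simp: U_def graph_union_def)
    then have "e \<in> nsets (verts (Gs i)) 2" using simple by (auto simp: simple_graph_def)
    then obtain x y where xy: "e = {x, y}" "x \<noteq> y" "x \<in> verts (Gs i)" "y \<in> verts (Gs i)"
      by (auto simp: nsets_def card_2_iff)
    then have V: "x \<in> verts U" "y \<in> verts U"
      using i unfolding U_def graph_union_def graph.sel by blast+
    have "(x, y) \<notin> r"
    proof
      assume "(x, y) \<in> r"
      then obtain q k l where "q \<in> {1..p}" "k \<in> {1..n}" "l \<in> {1..n}" "x = u k q" "y = u l q"
        using xy(2) unfolding r_def ident_rel_def by blast
      then show False using u_in_vertsD[of k i q] u_in_vertsD[of l i q] i xy by simp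
    qed
    then have "r `` {x} \<noteq> r `` {y}" using eq V by (simp add: eq_equiv_class_iff)
    then show ?thesis using V xy(1) by (auto simp: nsets_def quotientI)
  qed
  moreover have "amalgamation n p Gs u = quotient_graph U r"
    by (simp add: amalgamation_def Let_def U_def r_def)
  ultimately show ?thesis by (auto simp: quotient_graph_def simple_graph_def)
qed

end

end

theory Submission
  imports Defs "HOL-Combinatorics.Permutations"
begin

text \<open>Take, for each \<open>i\<close>, a cover of \<open>G\<^sub>i\<close> conducive to \<open>K\<^sub>i\<close> with the minimal number of colorings,
  labelled canonically over \<open>K\<^sub>i\<close>, and relabel its colors by a permutation \<open>\<sigma>\<^sub>i\<close> of \<open>[m]\<close>. Over the
  cliques all these covers still agree, so identifying vertices with equal labels gives an \<open>m\<close>-fold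
  cover of \<open>G\<close>, whose colorings are the tuples of colorings of the \<open>G\<^sub>i\<close> that agree on the clique after
  relabelling. A coloring uses \<open>p\<close> distinct labels on the clique, so each of its \<open>m(m-1)\<cdots>(m-p+1)\<close>
  possible restrictions to the clique is produced from a given coloring of \<open>G\<^sub>i\<close> by exactly
  \<open>(m-p)!\<close> permutations. Averaging the number of colorings over all \<open>(\<sigma>\<^sub>1,\<dots>,\<sigma>\<^sub>n)\<close> therefore gives
  the right-hand side, and some choice does at least as well as the average.\<close>

section \<open>Labelled covers and their colorings\<close>

text \<open>A labelled \<open>m\<close>-fold cover has \<^term>\<open>L x = {x} \<times> {1..m}\<close>; \<^term>\<open>A x j y k\<close> says that
  \<^term>\<open>(x, j)\<close> and \<^term>\<open>(y, k)\<close> are joined by a cross edge.\<close>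

definition labelled_cover :: "'a graph \<Rightarrow> nat \<Rightarrow> ('a \<Rightarrow> nat \<Rightarrow> 'a \<Rightarrow> nat \<Rightarrow> bool) \<Rightarrow> bool" where
  "labelled_cover G m A \<longleftrightarrow>
     (\<forall>x j y k. A x j y k \<longrightarrow> {x, y} \<in> edges G \<and> j \<in> {1..m} \<and> k \<in> {1..m} \<and> A y k x j) \<and>
     (\<forall>x j y k k'. A x j y k \<longrightarrow> A x j y k' \<longrightarrow> k = k')"

lemma labelled_coverD:
  assumes "labelled_cover G m A" "A x j y k"
  shows "{x, y} \<in> edges G" "j \<in> {1..m}" "k \<in> {1..m}" "A y k x j"
  using assms by (auto simp: labelled_cover_def)

text \<open>The definition asks for uniqueness of the second label only. By symmetry of
  \<open>A\<close> the first label is unique too, so the cross edges over an edge form a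
  matching.\<close>

lemma labelled_cover_unique:
  assumes "labelled_cover G m A" "A x j y k"
  shows "A x j y k' \<Longrightarrow> k' = k" "A x j' y k \<Longrightarrow> j' = j"
  using assms unfolding labelled_cover_def by blast+

text \<open>An independent set of size \<open>card (verts G)\<close> picks exactly one vertex from
  each list, hence a function from vertices to labels. Extensionality outside \<open>verts G\<close>
  makes each coloring count once. In a simple graph the pairs with \<open>x = y\<close> impose
  nothing, since \<open>A\<close> requires an edge \<open>{x, y}\<close>.\<close>

definition labelled_colorings ::
    "'a graph \<Rightarrow> nat \<Rightarrow> ('a \<Rightarrow> nat \<Rightarrow> 'a \<Rightarrow> nat \<Rightarrow> bool) \<Rightarrow> ('a \<Rightarrow> nat) set" where
  "labelled_colorings G m A =
     {f \<in> verts G \<rightarrow>\<^sub>E {1..m}. \<forall>x\<in>verts G. \<forall>y\<in>verts G. \<not> A x (f x) y (f y)}"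

lemma finite_labelled_colorings:
  "simple_graph G \<Longrightarrow> finite (labelled_colorings G m A)"
  by (simp add: labelled_colorings_def simple_graph_def finite_PiE)

section \<open>Passing between labelled covers and covers\<close>

text \<open>The cover graph lives on pairs: \<open>E1\<close> makes each list complete,
  \<open>E2\<close> holds the cross edges given by \<open>A\<close>. The count is bounded in the
  direction that bounds \<open>P_DP\<close> from above. With \<open>m \<ge> 1\<close> the lists are
  nonempty and distinct.\<close>

lemma fold_cover_of_labelled_cover:
  fixes G :: "'a graph"
  assumes G: "simple_graph G" and m: "m \<ge> 1" and A: "labelled_cover G m A"
  obtains L and H :: "('a \<times> nat) graph"
  where "fold_cover G m L H" "num_colorings G H \<le> card (labelled_colorings G m A)"
proof -
  define L where "L = (\<lambda>x :: 'a. {x} \<times> {1..m})"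
  define E1 where "E1 = {{(x, i), (x, j)} | x i j. x \<in> verts G \<and> i \<in> {1..m} \<and> j \<in> {1..m} \<and> i \<noteq> j}"
  define E2 where "E2 = {{(x, j), (y, k)} | x j y k. A x j y k}"
  define H where "H = Graph (verts G \<times> {1..m}) (E1 \<union> E2)"
  have fin: "finite (verts G)" using G by (simp add: simple_graph_def)
  have E1: "e \<in> nsets (verts H) 2" if "e \<in> E1" for e
    using that by (auto simp: E1_def H_def nsets_def)
  have E2: "e \<in> nsets (verts H) 2" if e: "e \<in> E2" for e
  proof -
    obtain x j y k where xy: "e = {(x, j), (y, k)}" "A x j y k" using e unfolding E2_def by blast
    note D = labelled_coverD[OF A xy(2)]
    show ?thesis using D(2,3) simple_graph_edgeD[OF G D(1)] by (auto simp: xy(1) nsets_def H_def)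
  qed
  have H: "simple_graph H" using E1 E2 fin by (auto simp: simple_graph_def H_def)
  \<comment> \<open>Edges are unordered, so this equivalence rests on the symmetry of
    \<open>A\<close>.\<close>
  have E2_iff: "{(x, j), (y, k)} \<in> E2 \<longleftrightarrow> A x j y k" for x j y k
    using labelled_coverD(4)[OF A] by (fastforce simp: E2_def doubleton_eq_iff)
  have edge_iff: "{(x, j), (y, k)} \<in> edges H \<longleftrightarrow> A x j y k" if "x \<noteq> y" for x j y k
  proof -
    have "{(x, j), (y, k)} \<notin> E1" using that by (auto simp: E1_def doubleton_eq_iff)
    then show ?thesis using E2_iff by (simp add: H_def)
  qed
  have mem1: "(x, 1) \<in> L y \<longleftrightarrow> x = y" for x y using m by (simp add: L_def)
  have injL: "inj_on L (verts G)" using mem1 by (metis inj_onI)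
  have edge1: "{(x, i), (x, j)} \<in> edges H"
    if "x \<in> verts G" "i \<in> {1..m}" "j \<in> {1..m}" "i \<noteq> j" for x i j
    using that unfolding H_def E1_def graph.sel by blast
  have "is_cover G L H"
    unfolding is_cover_def
  proof (intro conjI ballI allI impI)
    show "partition_on (verts H) (L ` verts G)"
      unfolding partition_on_def
    proof (intro conjI)
      show "\<Union> (L ` verts G) = verts H" by (auto simp: L_def H_def)
      show "disjoint (L ` verts G)" by (auto simp: disjoint_def L_def)
      show "{} \<notin> L ` verts G" using mem1 by blast
    qed
    show "card (L ` verts G) = card (verts G)" using injL by (rule card_image)
    show "clique (L x) (edges H)" if "x \<in> verts G" for x
      using edge1[OF that] by (auto simp: clique_def L_def)
  next
    fix x y assume "x \<in> verts G" "y \<in> verts G" "edges_between H (L x) (L y) \<noteq> {}"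
    then obtain i j where "{(x, i), (y, j)} \<in> edges H"
      by (auto simp: edges_between_def L_def)
    then show "x = y \<or> {x, y} \<in> edges G"
      using edge_iff labelled_coverD(1)[OF A] by blast
  next
    fix x y assume xy: "{x, y} \<in> edges G"
    then have ne: "x \<noteq> y" by (rule simple_graph_edgeD[OF G])
    have edgeE: "\<exists>j k. e = {(x, j), (y, k)} \<and> A x j y k" if e: "e \<in> edges_between H (L x) (L y)" for e
    proof -
      obtain j k where "e = {(x, j), (y, k)}" "e \<in> edges H"
        using e by (auto simp: edges_between_def L_def)
      then show ?thesis using edge_iff[OF ne] by blast
    qed
    show "disjoint (edges_between H (L x) (L y))"
    proof (rule disjointI)
      fix a b assume "a \<in> edges_between H (L x) (L y)" "b \<in> edges_between H (L x) (L y)" "a \<noteq> b"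
      then obtain j k j' k' where
        "a = {(x, j), (y, k)}" "A x j y k" "b = {(x, j'), (y, k')}" "A x j' y k'"
        using edgeE by meson
      moreover from this have "j \<noteq> j'" "k \<noteq> k'"
        using labelled_cover_unique[OF A \<open>A x j y k\<close>] \<open>a \<noteq> b\<close> by metis+
      ultimately show "a \<inter> b = {}" using ne by auto
    qed
  qed (rule H)
  moreover have "card (L x) = m" for x by (simp add: L_def card_cartesian_product)
  ultimately have "fold_cover G m L H" by (simp add: fold_cover_def)
  \<comment> \<open>Every coloring \<open>I\<close> turns out to be the graph of a labelled
    coloring, so the labelled colorings are at least as many.\<close>
  moreover have "{I. cover_coloring G H I} \<subseteq>
    (\<lambda>f. {(x, f x) | x. x \<in> verts G}) ` labelled_colorings G m A"
  proof
    fix I assume "I \<in> {I. cover_coloring G H I}"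
    then have I: "I \<subseteq> verts G \<times> {1..m}" "indep I (edges H)" "card I = card (verts G)"
      by (auto simp: cover_coloring_def H_def)
    \<comment> \<open>Two vertices of \<open>I\<close> in one list would be adjacent. The size of
      \<open>I\<close> then forces it to meet every list.\<close>
    have "inj_on fst I"
    proof (rule inj_onI)
      fix a b assume ab: "a \<in> I" "b \<in> I" "fst a = fst b"
      obtain x i j where "a = (x, i)" "b = (x, j)" using ab(3) by (metis prod.collapse)
      moreover from this have "x \<in> verts G" "i \<in> {1..m}" "j \<in> {1..m}" using ab I(1) by auto
      ultimately show "a = b"
        using edge1[of x i j] I(2) ab unfolding indep_def by blast
    qed
    moreover have "fst ` I \<subseteq> verts G" using I(1) by auto
    ultimately have img: "fst ` I = verts G"
      using I(3) fin by (metis card_image card_subset_eq)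
    then have "\<forall>x\<in>verts G. \<exists>j. (x, j) \<in> I" by force
    then obtain f0 where f0: "\<forall>x\<in>verts G. (x, f0 x) \<in> I" by metis
    define f where "f = restrict f0 (verts G)"
    have f: "(x, f x) \<in> I" if "x \<in> verts G" for x using that f0 by (simp add: f_def)
    have "I = {(x, f x) | x. x \<in> verts G}"
    proof
      show "I \<subseteq> {(x, f x) | x. x \<in> verts G}"
      proof
        fix a assume a: "a \<in> I"
        then have x: "fst a \<in> verts G" using I(1) by auto
        then have "a = (fst a, f (fst a))"
          using inj_onD[OF \<open>inj_on fst I\<close> _ a f[OF x]] by simp
        then show "a \<in> {(x, f x) | x. x \<in> verts G}" using x by blast
      qed
    qed (use f in auto)
    moreover have "f \<in> labelled_colorings G m A"
    proof -
      have "f x \<in> {1..m}" if "x \<in> verts G" for x using f[OF that] I(1) by auto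
      then have "f \<in> verts G \<rightarrow>\<^sub>E {1..m}" by (auto simp: f_def)
      moreover have "\<not> A x (f x) y (f y)" if xy: "x \<in> verts G" "y \<in> verts G" for x y
      proof
        assume a: "A x (f x) y (f y)"
        then have "x \<noteq> y" using labelled_coverD(1)[OF A] simple_graph_edgeD[OF G] by blast
        then have "{(x, f x), (y, f y)} \<in> edges H" using edge_iff a by simp
        then show False using I(2) f[OF xy(1)] f[OF xy(2)] \<open>x \<noteq> y\<close> unfolding indep_def by blast
      qed
      ultimately show ?thesis by (simp add: labelled_colorings_def)
    qed
    ultimately show "I \<in> (\<lambda>f. {(x, f x) | x. x \<in> verts G}) ` labelled_colorings G m A" by blast
  qed
  then have "num_colorings G H \<le> card (labelled_colorings G m A)"
    unfolding num_colorings_def by (rule surj_card_le[OF finite_labelled_colorings[OF G]])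
  ultimately show ?thesis by (rule that)
qed

text \<open>Number the vertices of each list by \<open>{1..m}\<close>, with the canonical names over
  \<open>K\<close> and an arbitrary bijection elsewhere, and read \<open>A\<close> off the edges of
  \<open>H\<close>. Distinct labelled colorings then select distinct independent sets of
  \<open>H\<close>.\<close>

lemma labelled_cover_of_conducive:
  fixes H :: "'h graph"
  assumes G: "simple_graph G" and K: "is_clique G K" and con: "conducive G K m L H"
  obtains A where "labelled_cover G m A"
    "\<And>x y j. x \<in> K \<Longrightarrow> y \<in> K \<Longrightarrow> x \<noteq> y \<Longrightarrow> j \<in> {1..m} \<Longrightarrow> A x j y j"
    "card (labelled_colorings G m A) \<le> num_colorings G H"
proof -
  have KV: "K \<subseteq> verts G" using K by (simp add: is_clique_def)
  have fc: "fold_cover G m L H" using con by (simp add: conducive_def full_cover_def)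
  then have cov: "is_cover G L H" and cardL: "\<And>x. x \<in> verts G \<Longrightarrow> card (L x) = m"
    by (auto simp: fold_cover_def)
  have H: "simple_graph H" using cov by (simp add: is_cover_def)
  then have finH: "finite (verts H)" by (simp add: simple_graph_def)
  have fin: "finite (verts G)" using G by (simp add: simple_graph_def)
  have part: "partition_on (verts H) (L ` verts G)" using cov by (simp add: is_cover_def)
  have Lsub: "L x \<subseteq> verts H" if "x \<in> verts G" for x
    using part that by (auto simp: partition_on_def)
  \<comment> \<open>The partition is a set of lists, so the cardinality condition is what keeps
    lists of different vertices apart.\<close>
  have "inj_on L (verts G)" using cov fin by (simp add: is_cover_def eq_card_imp_inj_on)
  then have Ldisj: "x = y" if "x \<in> verts G" "y \<in> verts G" "a \<in> L x" "a \<in> L y" for x y a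
  proof -
    have "L x = L y" using disjointD[OF partition_onD2[OF part], of "L x" "L y"] that by blast
    then show ?thesis using \<open>inj_on L (verts G)\<close> that by (simp add: inj_on_eq_iff)
  qed
  obtain name :: "'a \<times> nat \<Rightarrow> 'h" where
    "\<forall>x\<in>verts (induced G K). restrict L K x = {name (x, j) | j. j \<in> {1..m}}"
    and name_edge: "\<forall>x y. {x, y} \<in> edges (induced G K) \<longrightarrow>
      (\<forall>j\<in>{1..m}. {name (x, j), name (y, j)} \<in> edges (subcover_graph L H K))"
    using con[unfolded conducive_def canonical_labeling_def, THEN conjunct2]
    by (elim exE conjE) (rule that)
  moreover have "verts (induced G K) = K" using KV by (auto simp: induced_def)
  ultimately have nameL: "\<And>x. x \<in> K \<Longrightarrow> L x = {name (x, j) | j. j \<in> {1..m}}" by simp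
  have nameE: "{name (x, j), name (y, j)} \<in> edges H"
    if "x \<in> K" "y \<in> K" "x \<noteq> y" "j \<in> {1..m}" for x y j
  proof -
    have "{x, y} \<in> edges (induced G K)"
      using K that by (auto simp: is_clique_def clique_def induced_def)
    then have "{name (x, j), name (y, j)} \<in> edges (subcover_graph L H K)"
      using name_edge that(4) by blast
    then show ?thesis by (simp add: subcover_graph_def induced_def)
  qed
  have "\<exists>h. bij_betw h {1..m} (L x) \<and> (x \<in> K \<longrightarrow> h = (\<lambda>j. name (x, j)))"
    if x: "x \<in> verts G" for x
  proof (cases "x \<in> K")
    case True
    then have "L x = (\<lambda>j. name (x, j)) ` {1..m}" using nameL by auto
    moreover from this have "inj_on (\<lambda>j. name (x, j)) {1..m}"
      using cardL[OF x] by (intro eq_card_imp_inj_on) auto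
    ultimately have "bij_betw (\<lambda>j. name (x, j)) {1..m} (L x)" by (simp add: bij_betw_def)
    then show ?thesis by blast
  next
    case False
    have "finite (L x)" using Lsub[OF x] finH finite_subset by blast
    then have "\<exists>h. bij_betw h {1..m} (L x)" using cardL[OF x]
      by (intro finite_same_card_bij) auto
    then show ?thesis using False by blast
  qed
  then obtain h where h: "\<And>x. x \<in> verts G \<Longrightarrow> bij_betw (h x) {1..m} (L x)"
    and hK: "\<And>x. x \<in> K \<Longrightarrow> h x = (\<lambda>j. name (x, j))" using KV by (metis subsetD)
  have hL: "h x j \<in> L x" if "x \<in> verts G" "j \<in> {1..m}" for x j
    using bij_betw_apply[OF h[OF that(1)] that(2)] .
  have hinj: "j = k" if "h x j = h x k" "x \<in> verts G" "j \<in> {1..m}" "k \<in> {1..m}" for x j k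
    using inj_onD[OF bij_betw_imp_inj_on[OF h[OF that(2)]] that(1,3,4)] .
  \<comment> \<open>Requiring \<open>{x, y} \<in> edges G\<close> discards the edges inside a single
    list.\<close>
  define A where "A = (\<lambda>x j y k. {x, y} \<in> edges G \<and> j \<in> {1..m} \<and> k \<in> {1..m} \<and>
    {h x j, h y k} \<in> edges H)"
  have "labelled_cover G m A"
    unfolding labelled_cover_def
  proof (intro conjI allI impI)
    fix x j y k k' assume A: "A x j y k" "A x j y k'"
    then have xy: "{x, y} \<in> edges G" and jk: "j \<in> {1..m}" "k \<in> {1..m}" "k' \<in> {1..m}"
      by (auto simp: A_def)
    have V: "x \<in> verts G" "y \<in> verts G" using simple_graph_edgeD[OF G xy] by auto
    have "{h x j, h y k} \<in> edges_between H (L x) (L y)"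
      "{h x j, h y k'} \<in> edges_between H (L x) (L y)"
      using A hL[OF V(1) jk(1)] hL[OF V(2) jk(2)] hL[OF V(2) jk(3)]
      unfolding edges_between_def A_def by blast+
    moreover have "disjoint (edges_between H (L x) (L y))"
      using cov xy unfolding is_cover_def by blast
    \<comment> \<open>Two edges of a matching that share the endpoint \<open>h x j\<close>
      coincide.\<close>
    moreover have "{h x j, h y k} \<inter> {h x j, h y k'} \<noteq> {}" by simp
    ultimately have "{h x j, h y k} = {h x j, h y k'}" using disjointD by metis
    then have "h y k = h y k'" by (metis doubleton_eq_iff)
    then show "k = k'" by (rule hinj) (use V jk in simp_all)
  next
    fix x j y k assume "A x j y k"
    then show "{x, y} \<in> edges G" "j \<in> {1..m}" "k \<in> {1..m}" "A y k x j"
      unfolding A_def by (simp_all add: insert_commute)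
  qed
  moreover have "A x j y j" if "x \<in> K" "y \<in> K" "x \<noteq> y" "j \<in> {1..m}" for x y j
  proof -
    have "{x, y} \<in> edges G" using K that unfolding is_clique_def clique_def by blast
    then show ?thesis using nameE[OF that] that(4) by (simp add: A_def hK that(1,2))
  qed
  moreover have "card (labelled_colorings G m A) \<le> num_colorings G H"
    unfolding num_colorings_def
  proof (rule card_inj_on_le)
    let ?I = "\<lambda>f. (\<lambda>x. h x (f x)) ` verts G"
    have fm: "f x \<in> {1..m}" if "f \<in> labelled_colorings G m A" "x \<in> verts G" for f x
      using that by (auto simp: labelled_colorings_def)
    show "finite {I. cover_coloring G H I}"
      using finH by (rule_tac finite_subset[of _ "Pow (verts H)"]) (auto simp: cover_coloring_def)
    show "?I ` labelled_colorings G m A \<subseteq> {I. cover_coloring G H I}"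
    proof (rule image_subsetI, rule CollectI)
      fix f assume f: "f \<in> labelled_colorings G m A"
      have hf: "h x (f x) \<in> L x" if "x \<in> verts G" for x using hL that fm[OF f that] .
      have "inj_on (\<lambda>x. h x (f x)) (verts G)"
        by (rule inj_onI) (metis hf Ldisj)
      moreover have "?I f \<subseteq> verts H" using hf Lsub by blast
      \<comment> \<open>An edge of \<open>H\<close> between two lists exists only over an edge of
        \<open>G\<close>, so it would be a cross edge recorded by \<open>A\<close>, which
        \<open>f\<close> avoids.\<close>
      moreover have "{h x (f x), h y (f y)} \<notin> edges H"
        if xy: "x \<in> verts G" "y \<in> verts G" "h x (f x) \<noteq> h y (f y)" for x y
      proof
        assume e: "{h x (f x), h y (f y)} \<in> edges H"
        then have "edges_between H (L x) (L y) \<noteq> {}"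
          using hf[OF xy(1)] hf[OF xy(2)] unfolding edges_between_def by blast
        moreover have "x \<noteq> y" using xy by auto
        ultimately have "{x, y} \<in> edges G" using cov xy(1,2) unfolding is_cover_def by blast
        then have "A x (f x) y (f y)" using e fm[OF f] xy by (simp add: A_def)
        then show False using f xy(1,2) unfolding labelled_colorings_def by blast
      qed
      ultimately show "cover_coloring G H (?I f)"
        unfolding cover_coloring_def indep_def by (simp add: card_image)
    qed
    show "inj_on ?I (labelled_colorings G m A)"
    proof (rule inj_onI)
      fix f f' assume f: "f \<in> labelled_colorings G m A" "f' \<in> labelled_colorings G m A" "?I f = ?I f'"
      have "f x = f' x" if x: "x \<in> verts G" for x
      proof -
        obtain y where y: "y \<in> verts G" "h x (f x) = h y (f' y)" using f(3) x by blast
        \<comment> \<open>Lists are disjoint, so equal images come from the same vertex, and then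
          from the same label.\<close>
        then have "y = x" using Ldisj[of y x "h x (f x)"] hL[of x "f x"] hL[of y "f' y"] fm f x by simp
        then show ?thesis using y hinj[of x "f x" "f' x"] fm f x by simp
      qed
      moreover have "f \<in> extensional (verts G)" "f' \<in> extensional (verts G)"
        using f by (auto simp: labelled_colorings_def PiE_iff)
      ultimately show "f = f'" by (rule extensionalityI[rotated 2])
    qed
  qed
  ultimately show ?thesis by (rule that)
qed

section \<open>Counting permutations with prescribed values\<close>

lemma card_permutes_extending_le:
  assumes S: "finite S" and g: "inj_on g Q" "g ` Q \<subseteq> S" and h: "inj_on h Q" "h ` Q \<subseteq> S"
  shows "card {\<pi>. \<pi> permutes S \<and> (\<forall>q\<in>Q. \<pi> (g q) = h q)} \<le> fact (card S - card Q)"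
proof -
  let ?P = "{\<pi>. \<pi> permutes S \<and> (\<forall>q\<in>Q. \<pi> (g q) = h q)}"
  let ?A = "S - g ` Q" and ?B = "S - h ` Q"
  have fin: "finite ?A" "finite ?B" using S by auto
  have card: "card ?A = card S - card Q" "card ?B = card S - card Q"
    using card_Diff_subset[OF finite_subset[OF g(2) S] g(2)] card_Diff_subset[OF finite_subset[OF h(2) S] h(2)]
      card_image[OF g(1)] card_image[OF h(1)] by simp_all
  have "card ?P \<le> card {f \<in> ?A \<rightarrow>\<^sub>E ?B. inj_on f ?A}"
  proof (rule card_inj_on_le)
    show "inj_on (\<lambda>\<pi>. restrict \<pi> ?A) ?P"
    proof (rule inj_onI)
      fix \<pi> \<rho> assume *: "\<pi> \<in> ?P" "\<rho> \<in> ?P" and eq: "restrict \<pi> ?A = restrict \<rho> ?A"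
      show "\<pi> = \<rho>"
      proof
        fix x
        consider "x \<notin> S" | "x \<in> g ` Q" | "x \<in> ?A" by blast
        then show "\<pi> x = \<rho> x"
        proof cases
          case 1
          then show ?thesis using * permutes_not_in by (metis (no_types, lifting) mem_Collect_eq)
        next
          case 2
          then show ?thesis using * by auto
        next
          case 3
          then show ?thesis using fun_cong[OF eq, of x] by simp
        qed
      qed
    qed
    show "(\<lambda>\<pi>. restrict \<pi> ?A) ` ?P \<subseteq> {f \<in> ?A \<rightarrow>\<^sub>E ?B. inj_on f ?A}"
    proof (rule image_subsetI)
      fix \<pi> assume \<pi>: "\<pi> \<in> ?P"
      then have perm: "\<pi> permutes S" and eq: "\<And>q. q \<in> Q \<Longrightarrow> \<pi> (g q) = h q" by auto
      have "\<pi> x \<in> ?B" if x: "x \<in> ?A" for x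
      proof -
        have "\<pi> x \<noteq> h q" if "q \<in> Q" for q
          using eq[OF that] inj_eq[OF permutes_inj[OF perm], of x "g q"] x that by auto
        then show ?thesis using x permutes_in_image[OF perm] by auto
      qed
      moreover have "inj_on \<pi> ?A" using permutes_inj[OF perm] by (rule inj_on_subset) simp
      ultimately show "restrict \<pi> ?A \<in> {f \<in> ?A \<rightarrow>\<^sub>E ?B. inj_on f ?A}" by auto
    qed
    show "finite {f \<in> ?A \<rightarrow>\<^sub>E ?B. inj_on f ?A}" using fin by (simp add: finite_PiE)
  qed
  also have "\<dots> = (\<Prod>i = 0..<card ?A. card ?B - i)"
    using card_inj_on_subset_funcset[OF fin subset_refl] by simp
  also have "\<dots> = fact (card S - card Q)"
    unfolding card by (simp add: fact_prod_rev)
  finally show ?thesis .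
qed

text \<open>Double counting of the pairs of a permutation \<open>\<pi>\<close> and a matching
  \<open>f\<close>: for fixed \<open>f\<close> the preceding bound applies with
  \<open>h q = f (v q)\<close>.\<close>

lemma sum_permutes_card_matching_le:
  assumes S: "finite S" and C: "finite C" and g: "inj_on g Q" "g ` Q \<subseteq> S"
    and v: "\<And>f. f \<in> C \<Longrightarrow> inj_on (\<lambda>q. f (v q)) Q" "\<And>f. f \<in> C \<Longrightarrow> (\<lambda>q. f (v q)) ` Q \<subseteq> S"
  shows "(\<Sum>\<pi> | \<pi> permutes S. card {f \<in> C. \<forall>q\<in>Q. f (v q) = \<pi> (g q)})
    \<le> card C * fact (card S - card Q)"
proof -
  let ?R = "\<lambda>\<pi> f. \<forall>q\<in>Q. f (v q) = \<pi> (g q)"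
  have "(\<Sum>\<pi> | \<pi> permutes S. card {f \<in> C. ?R \<pi> f}) =
    (\<Sum>\<pi> | \<pi> permutes S. \<Sum>f | f \<in> C \<and> ?R \<pi> f. 1)"
    by simp
  also have "\<dots> = (\<Sum>f\<in>C. \<Sum>\<pi> | \<pi> \<in> {\<pi>. \<pi> permutes S} \<and> ?R \<pi> f. 1)"
    by (rule sum.swap_restrict) (use S C in \<open>auto simp: finite_permutations\<close>)
  also have "\<dots> = (\<Sum>f\<in>C. card {\<pi>. \<pi> permutes S \<and> (\<forall>q\<in>Q. \<pi> (g q) = f (v q))})"
    by (intro sum.cong refl) (simp add: eq_commute)
  also have "\<dots> \<le> (\<Sum>f\<in>C. fact (card S - card Q))"
    by (intro sum_mono card_permutes_extending_le S g v)
  finally show ?thesis by simp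
qed

section \<open>Gluing relabelled covers and averaging over the relabellings\<close>

context
  fixes n p m :: nat and Gs :: "nat \<Rightarrow> 'a graph" and u :: "nat \<Rightarrow> nat \<Rightarrow> 'a"
    and A :: "nat \<Rightarrow> 'a \<Rightarrow> nat \<Rightarrow> 'a \<Rightarrow> nat \<Rightarrow> bool"
  assumes simple: "\<And>i. i \<in> {1..n} \<Longrightarrow> simple_graph (Gs i)"
    and disj: "disjoint_family_on (\<lambda>i. verts (Gs i)) {1..n}"
    and inj: "\<And>i. i \<in> {1..n} \<Longrightarrow> inj_on (u i) {1..p}"
    and u_verts: "\<And>i. i \<in> {1..n} \<Longrightarrow> u i ` {1..p} \<subseteq> verts (Gs i)"
    and cover: "\<And>i. i \<in> {1..n} \<Longrightarrow> labelled_cover (Gs i) m (A i)"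
    and canonical: "\<And>i q q' j. i \<in> {1..n} \<Longrightarrow> q \<in> {1..p} \<Longrightarrow> q' \<in> {1..p} \<Longrightarrow> q \<noteq> q' \<Longrightarrow>
      j \<in> {1..m} \<Longrightarrow> A i (u i q) j (u i q') j"
    and n: "n \<ge> 1" and m: "m \<ge> 1"
begin

text \<open>Label \<open>j\<close> of the glued cover stands for label \<open>\<sigma> i j\<close>
  of \<open>A i\<close>. A glued coloring is determined by its restrictions to the
  \<open>Gs i\<close>, which must all agree with one injective labelling \<open>g\<close> of the
  merged clique. For fixed \<open>g\<close> the restrictions are counted independently, hence the
  product.\<close>

lemma P_DP_amalgamation_le_sum:
  assumes \<sigma>: "\<And>i. i \<in> {1..n} \<Longrightarrow> \<sigma> i permutes {1..m}"
  shows "P_DP (amalgamation n p Gs u) m \<le>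
    (\<Sum>g | g \<in> {1..p} \<rightarrow>\<^sub>E {1..m} \<and> inj_on g {1..p}. \<Prod>i=1..n.
       card {f \<in> labelled_colorings (Gs i) m (A i). \<forall>q\<in>{1..p}. f (u i q) = \<sigma> i (g q)})"
proof -
  define V where "V = verts (graph_union {1..n} Gs)"
  define r where "r = ident_rel V n p u"
  define cls where "cls = (\<lambda>x. r `` {x})"
  define G where "G = amalgamation n p Gs u"
  have eq: "equiv V r"
    unfolding V_def r_def using equiv_ident_rel[of n Gs u p] simple disj inj u_verts by blast
  have G: "simple_graph G"
    unfolding G_def using simple_graph_amalgamation[of n Gs u p] simple disj inj u_verts by blast
  have V_iff: "x \<in> V \<longleftrightarrow> (\<exists>i\<in>{1..n}. x \<in> verts (Gs i))" for x
    by (simp add: V_def graph_union_def)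
  have vG: "verts G = cls ` V"
    by (auto simp: G_def amalgamation_def Let_def quotient_graph_def quotient_def cls_def r_def V_def)
  have eG: "{cls x, cls y} \<in> edges G" if "i \<in> {1..n}" "{x, y} \<in> edges (Gs i)" for i x y
  proof -
    have "{x, y} \<in> edges (graph_union {1..n} Gs)" using that unfolding graph_union_def graph.sel by blast
    then have "cls ` {x, y} \<in> edges G"
      unfolding G_def amalgamation_def Let_def quotient_graph_def graph.sel cls_def r_def V_def
      by (rule imageI)
    then show ?thesis by simp
  qed
  \<comment> \<open>Only copies of the same clique vertex in different graphs are merged, so a class
    contains at most one vertex of each graph.\<close>
  have cls_eqD: "x = y \<or> (\<exists>q\<in>{1..p}. x = u i q \<and> y = u j q \<and> i \<noteq> j)"
    if i: "i \<in> {1..n}" "j \<in> {1..n}" and x: "x \<in> verts (Gs i)" "y \<in> verts (Gs j)"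
      and cls: "cls x = cls y" for i j x y
  proof (cases "x = y")
    case False
    have "x \<in> V" "y \<in> V" using i x V_iff by blast+
    then have "(x, y) \<in> r" using cls eq_equiv_class_iff[OF eq] by (simp add: cls_def)
    then obtain q i' j' where q: "q \<in> {1..p}" "i' \<in> {1..n}" "j' \<in> {1..n}" "x = u i' q" "y = u j' q"
      using False unfolding r_def ident_rel_def by blast
    have "u i' q \<in> verts (Gs i')" "u j' q \<in> verts (Gs j')" using u_verts q by blast+
    then have "i' = i" "j' = j" using disj i x q unfolding disjoint_family_on_def by blast+
    then show ?thesis using q False by auto
  qed simp
  have graph_eq: "i = j" if "i \<in> {1..n}" "j \<in> {1..n}" "x \<in> verts (Gs i)" "x \<in> verts (Gs j)" for i j x
    using disj that unfolding disjoint_family_on_def by blast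
  have cls_same: "x = y" if "i \<in> {1..n}" "x \<in> verts (Gs i)" "y \<in> verts (Gs i)" "cls x = cls y" for i x y
    using cls_eqD[of i i x y] that by blast
  have cls_u: "cls (u i q) = cls (u j q)" if "i \<in> {1..n}" "j \<in> {1..n}" "q \<in> {1..p}" for i j q
  proof -
    have "u i q \<in> V" "u j q \<in> V" using that u_verts V_iff by blast+
    then have "(u i q, u j q) \<in> r" using that unfolding r_def ident_rel_def by blast
    then show ?thesis using equiv_class_eq[OF eq] by (simp add: cls_def)
  qed
  have \<sigma>_eq: "\<sigma> i j = \<sigma> i k \<longleftrightarrow> j = k" if "i \<in> {1..n}" for i j k
    using inj_eq[OF permutes_inj[OF \<sigma>[OF that]]] .
  have \<sigma>_in: "\<sigma> i j \<in> {1..m} \<longleftrightarrow> j \<in> {1..m}" if "i \<in> {1..n}" for i j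
    using permutes_in_image[OF \<sigma>[OF that]] .
  have A_verts: "x \<in> verts (Gs i)" "y \<in> verts (Gs i)" "x \<noteq> y"
    if "i \<in> {1..n}" "A i x j y k" for i x j y k
    using simple_graph_edgeD[OF simple[OF that(1)] labelled_coverD(1)[OF cover[OF that(1)] that(2)]] .
  \<comment> \<open>Cross edges of all covers are pulled back along the relabellings and pushed to
    the classes.\<close>
  define B where "B = (\<lambda>C j D k. \<exists>i\<in>{1..n}. \<exists>x y. C = cls x \<and> D = cls y \<and> A i x (\<sigma> i j) y (\<sigma> i k))"
  have B: "labelled_cover G m B"
    unfolding labelled_cover_def
  proof (intro conjI allI impI)
    fix C j D k assume "B C j D k"
    then obtain i x y where i: "i \<in> {1..n}" and CD: "C = cls x" "D = cls y"
      and a: "A i x (\<sigma> i j) y (\<sigma> i k)" unfolding B_def by blast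
    note D = labelled_coverD[OF cover[OF i] a]
    show "{C, D} \<in> edges G" using eG[OF i D(1)] CD by simp
    show "j \<in> {1..m}" "k \<in> {1..m}" using D(2,3) \<sigma>_in[OF i] by simp_all
    show "B D k C j" using D(4) i CD unfolding B_def by blast
  next
    fix C j D k k' assume "B C j D k" "B C j D k'"
    then obtain i x y i' x' y' where i: "i \<in> {1..n}" "i' \<in> {1..n}"
      and C: "C = cls x" "C = cls x'" and D: "D = cls y" "D = cls y'"
      and a: "A i x (\<sigma> i j) y (\<sigma> i k)" and a': "A i' x' (\<sigma> i' j) y' (\<sigma> i' k')"
      unfolding B_def by blast
    note W = A_verts[OF i(1) a] A_verts[OF i(2) a']
    show "k = k'"
    proof (cases "i = i'")
      case True
      have "x' = x" using cls_same[of i x' x] C True i W by simp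
      moreover have "y' = y" using cls_same[of i y' y] D True i W by simp
      ultimately have "\<sigma> i k' = \<sigma> i k"
        using labelled_cover_unique(1)[OF cover[OF i(1)] a] a' True by simp
      then show ?thesis using \<sigma>_eq i by simp
    next
      \<comment> \<open>Two graphs can contribute edges between the same classes only inside the
        merged clique. There the canonical labeling joins equal labels, so both \<open>k\<close> and
        \<open>k'\<close> equal \<open>j\<close>. This survives the relabellings because each
        \<open>\<sigma> i\<close> acts on all vertices of its graph at once.\<close>
      case False
      then have ne: "x \<noteq> x'" "y \<noteq> y'" using graph_eq i W by blast+
      obtain q where q: "q \<in> {1..p}" "x = u i q" "x' = u i' q"
        using cls_eqD[of i i' x x'] C i W ne by auto
      obtain q' where q': "q' \<in> {1..p}" "y = u i q'" "y' = u i' q'"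
        using cls_eqD[of i i' y y'] D i W ne by auto
      have "q \<noteq> q'" using q q' W by auto
      have "\<sigma> i j \<in> {1..m}" "\<sigma> i' j \<in> {1..m}"
        using labelled_coverD(2)[OF cover[OF i(1)] a] labelled_coverD(2)[OF cover[OF i(2)] a'] .
      then have "A i x (\<sigma> i j) y (\<sigma> i j)" "A i' x' (\<sigma> i' j) y' (\<sigma> i' j)"
        using canonical i q q' \<open>q \<noteq> q'\<close> by simp_all
      then have "\<sigma> i j = \<sigma> i k" "\<sigma> i' j = \<sigma> i' k'"
        using labelled_cover_unique(1)[OF cover[OF i(1)] a] labelled_cover_unique(1)[OF cover[OF i(2)] a']
        by blast+
      then show ?thesis using \<sigma>_eq i by simp
    qed
  qed
  obtain L and H :: "('a set \<times> nat) graph"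
    where H: "fold_cover G m L H" "num_colorings G H \<le> card (labelled_colorings G m B)"
    using fold_cover_of_labelled_cover[OF G m B] .
  let ?Gg = "{g \<in> {1..p} \<rightarrow>\<^sub>E {1..m}. inj_on g {1..p}}"
  let ?F = "\<lambda>g i. {f \<in> labelled_colorings (Gs i) m (A i). \<forall>q\<in>{1..p}. f (u i q) = \<sigma> i (g q)}"
  have finG: "finite ?Gg" by (simp add: finite_PiE)
  have finF: "finite (?F g i)" if "i \<in> {1..n}" for g i
    using finite_labelled_colorings[OF simple[OF that]] by simp
  have "card (labelled_colorings G m B) \<le> card (\<Union>g\<in>?Gg. Pi\<^sub>E {1..n} (?F g))"
  proof (rule card_inj_on_le)
    \<comment> \<open>A glued coloring is sent to the tuple of its restrictions, translated back
      into the labels of the \<open>A i\<close>.\<close>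
    let ?\<Phi> = "\<lambda>\<phi>. \<lambda>i\<in>{1..n}. \<lambda>x\<in>verts (Gs i). \<sigma> i (\<phi> (cls x))"
    have clsG: "cls x \<in> verts G" if "i \<in> {1..n}" "x \<in> verts (Gs i)" for i x
      using that V_iff vG by blast
    show "finite (\<Union>g\<in>?Gg. Pi\<^sub>E {1..n} (?F g))"
      using finG finF by (intro finite_UN_I finite_PiE) auto
    show "?\<Phi> ` labelled_colorings G m B \<subseteq> (\<Union>g\<in>?Gg. Pi\<^sub>E {1..n} (?F g))"
    proof (rule image_subsetI)
      fix \<phi> assume "\<phi> \<in> labelled_colorings G m B"
      then have \<phi>: "\<And>C. C \<in> verts G \<Longrightarrow> \<phi> C \<in> {1..m}"
        and \<phi>B: "\<And>C D. C \<in> verts G \<Longrightarrow> D \<in> verts G \<Longrightarrow> \<not> B C (\<phi> C) D (\<phi> D)"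
        unfolding labelled_colorings_def by auto
      \<comment> \<open>The copies in graph 1 serve as representatives of the merged vertices. By
        \<open>cls_u\<close> every graph gives the same \<open>g\<close>.\<close>
      define g where "g = (\<lambda>q\<in>{1..p}. \<phi> (cls (u 1 q)))"
      have one: "1 \<in> {1..n}" using n by simp
      have uV: "u i q \<in> verts (Gs i)" if "i \<in> {1..n}" "q \<in> {1..p}" for i q using that u_verts by blast
      have "inj_on g {1..p}"
      proof (rule inj_onI, rule ccontr)
        fix q q' assume q: "q \<in> {1..p}" "q' \<in> {1..p}" "g q = g q'" "q \<noteq> q'"
        let ?C = "cls (u 1 q)" and ?D = "cls (u 1 q')"
        have "\<phi> ?C = \<phi> ?D" using q by (simp add: g_def)
        have CD: "?C \<in> verts G" "?D \<in> verts G" using clsG[OF one] uV[OF one] q by blast+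
        \<comment> \<open>Equal labels on two clique vertices would be joined by a canonical cross
          edge.\<close>
        have "A 1 (u 1 q) (\<sigma> 1 (\<phi> ?C)) (u 1 q') (\<sigma> 1 (\<phi> ?C))"
          using canonical[OF one q(1,2,4)] \<sigma>_in[OF one] \<phi>[OF CD(1)] by blast
        then have "B ?C (\<phi> ?C) ?D (\<phi> ?D)" using one \<open>\<phi> ?C = \<phi> ?D\<close> unfolding B_def by metis
        then show False using \<phi>B[OF CD] by blast
      qed
      moreover have "g \<in> {1..p} \<rightarrow>\<^sub>E {1..m}"
      proof (rule PiE_I)
        fix q assume q: "q \<in> {1..p}"
        then show "g q \<in> {1..m}" using \<phi>[OF clsG[OF one uV[OF one q]]] by (simp add: g_def)
      qed (auto simp: g_def)
      ultimately have g: "g \<in> ?Gg" by simp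
      have "?\<Phi> \<phi> i \<in> ?F g i" if i: "i \<in> {1..n}" for i
      proof -
        let ?f = "\<lambda>x\<in>verts (Gs i). \<sigma> i (\<phi> (cls x))"
        have "?f x \<in> {1..m}" if x: "x \<in> verts (Gs i)" for x
          using \<phi>[OF clsG[OF i x]] \<sigma>_in[OF i] x by simp
        then have "?f \<in> verts (Gs i) \<rightarrow>\<^sub>E {1..m}" by (intro PiE_I) simp_all
        moreover have "\<not> A i x (?f x) y (?f y)" if xy: "x \<in> verts (Gs i)" "y \<in> verts (Gs i)" for x y
        proof
          assume "A i x (?f x) y (?f y)"
          then have "A i x (\<sigma> i (\<phi> (cls x))) y (\<sigma> i (\<phi> (cls y)))" using xy by simp
          then have "B (cls x) (\<phi> (cls x)) (cls y) (\<phi> (cls y))"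
            using i unfolding B_def by blast
          then show False using \<phi>B clsG[OF i] xy by blast
        qed
        moreover have "?f (u i q) = \<sigma> i (g q)" if q: "q \<in> {1..p}" for q
          using uV[OF i q] cls_u[OF i one q] q by (simp add: g_def)
        ultimately show ?thesis using i by (simp add: labelled_colorings_def)
      qed
      then have "?\<Phi> \<phi> \<in> Pi\<^sub>E {1..n} (?F g)" by (simp add: PiE_iff)
      then show "?\<Phi> \<phi> \<in> (\<Union>g\<in>?Gg. Pi\<^sub>E {1..n} (?F g))" using g by blast
    qed
    show "inj_on ?\<Phi> (labelled_colorings G m B)"
    proof (rule inj_onI)
      fix \<phi> \<psi> assume *: "\<phi> \<in> labelled_colorings G m B" "\<psi> \<in> labelled_colorings G m B"
        and eq: "?\<Phi> \<phi> = ?\<Phi> \<psi>"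
      have "\<phi> C = \<psi> C" if C: "C \<in> verts G" for C
      \<comment> \<open>Every class has a representative in some graph, and the injective
        \<open>\<sigma> i\<close> lets the label be recovered there.\<close>
      proof -
        obtain i x where ix: "i \<in> {1..n}" "x \<in> verts (Gs i)" "C = cls x"
          using C vG V_iff by auto
        then have "\<sigma> i (\<phi> C) = \<sigma> i (\<psi> C)" using fun_cong[OF fun_cong[OF eq, of i], of x] by simp
        then show ?thesis using \<sigma>_eq ix by simp
      qed
      moreover have "\<phi> \<in> extensional (verts G)" "\<psi> \<in> extensional (verts G)"
        using * by (auto simp: labelled_colorings_def PiE_iff)
      ultimately show "\<phi> = \<psi>" by (rule extensionalityI[rotated 2])
    qed
  qed
  also have "\<dots> \<le> (\<Sum>g\<in>?Gg. card (Pi\<^sub>E {1..n} (?F g)))" by (rule card_UN_le[OF finG])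
  also have "\<dots> = (\<Sum>g\<in>?Gg. \<Prod>i=1..n. card (?F g i))" by (simp add: card_PiE)
  finally show ?thesis using P_DP_le[OF G H(1)] H(2) unfolding G_def by linarith
qed

text \<open>The preceding bound is summed over all \<open>fact m ^ n\<close> tuples of relabellings.
  The average thus appears with its denominator cleared, which keeps the inequality in the natural
  numbers.\<close>

lemma P_DP_amalgamation_average:
  "fact m ^ n * P_DP (amalgamation n p Gs u) m \<le>
    (\<Prod>i<p. m - i) * (\<Prod>i=1..n. card (labelled_colorings (Gs i) m (A i)) * fact (m - p))"
proof -
  let ?P = "{\<pi>. \<pi> permutes {1..m}}"
  let ?Gg = "{g \<in> {1..p} \<rightarrow>\<^sub>E {1..m}. inj_on g {1..p}}"
  let ?c = "\<lambda>g i \<pi>. card {f \<in> labelled_colorings (Gs i) m (A i). \<forall>q\<in>{1..p}. f (u i q) = \<pi> (g q)}"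
  have finP: "finite ?P" by (simp add: finite_permutations)
  have "fact m ^ n * P_DP (amalgamation n p Gs u) m =
    (\<Sum>\<sigma>\<in>{1..n} \<rightarrow>\<^sub>E ?P. P_DP (amalgamation n p Gs u) m)"
    using card_permutations[of "{1..m}" m] by (simp add: card_PiE)
  also have "\<dots> \<le> (\<Sum>\<sigma>\<in>{1..n} \<rightarrow>\<^sub>E ?P. \<Sum>g\<in>?Gg. \<Prod>i=1..n. ?c g i (\<sigma> i))"
    by (intro sum_mono P_DP_amalgamation_le_sum) auto
  also have "\<dots> = (\<Sum>g\<in>?Gg. \<Sum>\<sigma>\<in>{1..n} \<rightarrow>\<^sub>E ?P. \<Prod>i=1..n. ?c g i (\<sigma> i))"
    by (rule sum.swap)
  \<comment> \<open>For fixed \<open>g\<close> each factor depends on its own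
    \<open>\<sigma> i\<close> only, so the sum over tuples factors.\<close>
  also have "\<dots> = (\<Sum>g\<in>?Gg. \<Prod>i=1..n. \<Sum>\<pi>\<in>?P. ?c g i \<pi>)"
    using finP by (intro sum.cong refl prod_sum_PiE[symmetric]) auto
  \<comment> \<open>The double-counting bound no longer depends on \<open>g\<close>, so the outer
    sum becomes multiplication by the number of injections from \<open>{1..p}\<close> to
    \<open>{1..m}\<close>.\<close>
  also have "\<dots> \<le> (\<Sum>g\<in>?Gg. \<Prod>i=1..n. card (labelled_colorings (Gs i) m (A i)) * fact (m - p))"
  proof (intro sum_mono prod_mono conjI)
    fix g i assume g: "g \<in> ?Gg" and i: "i \<in> {1..n}"
    have img: "g ` {1..p} \<subseteq> {1..m}" using g by auto
    have uV: "u i q \<in> verts (Gs i)" if "q \<in> {1..p}" for q using that i u_verts by blast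
    have "inj_on (\<lambda>q. f (u i q)) {1..p}" "(\<lambda>q. f (u i q)) ` {1..p} \<subseteq> {1..m}"
      if f: "f \<in> labelled_colorings (Gs i) m (A i)" for f
    proof -
      have fm: "f (u i q) \<in> {1..m}" if "q \<in> {1..p}" for q
        using f uV[OF that] unfolding labelled_colorings_def by blast
      then show "(\<lambda>q. f (u i q)) ` {1..p} \<subseteq> {1..m}" by blast
      show "inj_on (\<lambda>q. f (u i q)) {1..p}"
      proof (rule inj_onI, rule ccontr)
        fix q q' assume q: "q \<in> {1..p}" "q' \<in> {1..p}" "f (u i q) = f (u i q')" "q \<noteq> q'"
        then have "A i (u i q) (f (u i q)) (u i q') (f (u i q'))"
          using canonical[OF i q(1,2,4) fm[OF q(1)]] by simp
        then show False using f uV q unfolding labelled_colorings_def by blast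
      qed
    qed
    then have "(\<Sum>\<pi>\<in>?P. ?c g i \<pi>)
      \<le> card (labelled_colorings (Gs i) m (A i)) * fact (card {1..m} - card {1..p})"
      using g img finite_labelled_colorings[OF simple[OF i]]
      by (intro sum_permutes_card_matching_le) auto
    then show "(\<Sum>\<pi>\<in>?P. ?c g i \<pi>) \<le> card (labelled_colorings (Gs i) m (A i)) * fact (m - p)"
      by simp
  qed simp
  also have "\<dots> = card ?Gg * (\<Prod>i=1..n. card (labelled_colorings (Gs i) m (A i)) * fact (m - p))"
    by simp
  also have "card ?Gg = (\<Prod>i<p. m - i)"
    using card_inj_on_subset_funcset[of "{1..p}" "{1..m}" "{1..p}"] by (simp add: atLeast0LessThan)
  finally show ?thesis .
qed

end

section \<open>Optimal conducive covers and the final inequality\<close>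

lemma conducive_cover_attaining_P_DP_can:
  assumes "simple_graph G" "K \<subseteq> verts G" "m \<ge> 1"
  obtains L and H :: "nat graph" where "conducive G K m L H" "num_colorings G H = P_DP_can G K m"
proof -
  have "{num_colorings G H | L (H :: nat graph). conducive G K m L H} \<noteq> {}"
    using conducive_cover_exists[OF assms] by blast
  then have "P_DP_can G K m \<in> {num_colorings G H | L (H :: nat graph). conducive G K m L H}"
    unfolding P_DP_can_def by (rule Inf_nat_def1)
  then show ?thesis using that by auto
qed

lemma fact_eq_falling_prod:
  "p \<le> m \<Longrightarrow> fact m = (\<Prod>i<p. m - i) * (fact (m - p) :: nat)"
proof (induction p)
  case (Suc p)
  then have "fact (m - p) = (m - p) * (fact (m - Suc p) :: nat)"
    by (simp add: fact_reduce)
  then show ?case using Suc by simp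
qed simp

theorem theorem5:
  fixes n p m :: nat
    and Gs :: "nat \<Rightarrow> 'a graph"
    and u :: "nat \<Rightarrow> nat \<Rightarrow> 'a"
    and K :: "nat \<Rightarrow> 'a set"
    and G :: "'a set graph"
  assumes "n \<ge> 2" and "p \<ge> 1"
    and "\<And>i. i \<in> {1..n} \<Longrightarrow> simple_graph (Gs i)"
    and "disjoint_family_on (\<lambda>i. verts (Gs i)) {1..n}"
    and "\<And>i. i \<in> {1..n} \<Longrightarrow> inj_on (u i) {1..p}"
    and "\<And>i. i \<in> {1..n} \<Longrightarrow> K i = u i ` {1..p}"
    and "\<And>i. i \<in> {1..n} \<Longrightarrow> is_clique (Gs i) (K i)"
    and "G = amalgamation n p Gs u"
    and "m \<ge> p"
  shows "real (P_DP G m) \<le>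
     (\<Prod>i=1..n. real (P_DP_can (Gs i) (K i) m)) / (\<Prod>i<p. real m - real i) ^ (n - 1)"
proof -
  note simple = assms(3) and disj = assms(4) and inj = assms(5) and K = assms(6)
    and clique = assms(7)
  have n: "n \<ge> 1" and m: "m \<ge> 1" using assms by auto
  have KV: "u i ` {1..p} \<subseteq> verts (Gs i)" if "i \<in> {1..n}" for i
    using clique[OF that] K[OF that] by (simp add: is_clique_def)
  have "\<exists>A. labelled_cover (Gs i) m A \<and>
    (\<forall>x\<in>K i. \<forall>y\<in>K i. x \<noteq> y \<longrightarrow> (\<forall>j\<in>{1..m}. A x j y j)) \<and>
    card (labelled_colorings (Gs i) m A) \<le> P_DP_can (Gs i) (K i) m" if i: "i \<in> {1..n}" for i
  proof -
    have "K i \<subseteq> verts (Gs i)" using KV[OF i] K[OF i] by simp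
    then obtain L and H :: "nat graph"
      where LH: "conducive (Gs i) (K i) m L H" "num_colorings (Gs i) H = P_DP_can (Gs i) (K i) m"
      using conducive_cover_attaining_P_DP_can[OF simple[OF i] _ m] by blast
    show ?thesis
      by (rule labelled_cover_of_conducive[OF simple[OF i] clique[OF i] LH(1)]) (use LH(2) in auto)
  qed
  then obtain A where A: "\<And>i. i \<in> {1..n} \<Longrightarrow> labelled_cover (Gs i) m (A i)"
    and A_K: "\<And>i. i \<in> {1..n} \<Longrightarrow>
      \<forall>x\<in>K i. \<forall>y\<in>K i. x \<noteq> y \<longrightarrow> (\<forall>j\<in>{1..m}. A i x j y j)"
    and A_card: "\<And>i. i \<in> {1..n} \<Longrightarrow>
      card (labelled_colorings (Gs i) m (A i)) \<le> P_DP_can (Gs i) (K i) m"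
    by metis
  have canonical: "A i (u i q) j (u i q') j"
    if "i \<in> {1..n}" "q \<in> {1..p}" "q' \<in> {1..p}" "q \<noteq> q'" "j \<in> {1..m}" for i q q' j
    using that A_K[OF that(1)] K[OF that(1)] inj_on_eq_iff[OF inj[OF that(1)]] by auto
  \<comment> \<open>\<open>D\<close> counts the labellings of the clique by distinct labels,
    \<open>F\<close> the permutations extending one of them.\<close>
  define D where "D = (\<Prod>i<p. m - i)"
  define F where "F = (fact (m - p) :: nat)"
  have fact_m: "fact m = D * F"
    unfolding D_def F_def using assms(9) by (rule fact_eq_falling_prod)
  have "D > 0" unfolding D_def using assms(9) by (simp add: prod_pos)
  have "F > 0" unfolding F_def by simp
  have "fact m ^ n * P_DP G m \<le>
      D * (\<Prod>i=1..n. card (labelled_colorings (Gs i) m (A i)) * F)"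
    unfolding assms(8) D_def F_def
    by (rule P_DP_amalgamation_average[OF simple disj inj KV A canonical n m])
  also have "\<dots> \<le> D * (\<Prod>i=1..n. P_DP_can (Gs i) (K i) m * F)"
    by (intro mult_left_mono prod_mono conjI mult_right_mono A_card) auto
  also have "\<dots> = D * ((\<Prod>i=1..n. P_DP_can (Gs i) (K i) m) * F ^ n)"
    by (simp add: prod.distrib)
  \<comment> \<open>Here \<open>fact m ^ n\<close> is written as
    \<open>(D * F ^ n) * D ^ (n - 1)\<close>: one factor \<open>D\<close> on the right comes from
    the choice of \<open>g\<close>, so cancelling leaves the exponent \<open>n - 1\<close>.\<close>
  finally have "(D * F ^ n) * (D ^ (n - 1) * P_DP G m)
      \<le> (D * F ^ n) * (\<Prod>i=1..n. P_DP_can (Gs i) (K i) m)"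
    using n by (simp add: fact_m power_mult_distrib power_eq_if[of D n] ac_simps)
  then have "D ^ (n - 1) * P_DP G m \<le> (\<Prod>i=1..n. P_DP_can (Gs i) (K i) m)"
    using \<open>D > 0\<close> \<open>F > 0\<close> by simp
  then have "real (D ^ (n - 1) * P_DP G m) \<le> real (\<Prod>i=1..n. P_DP_can (Gs i) (K i) m)"
    by (rule of_nat_mono)
  then have "real D ^ (n - 1) * real (P_DP G m) \<le> (\<Prod>i=1..n. real (P_DP_can (Gs i) (K i) m))"
    by simp
  \<comment> \<open>Truncated and real subtraction agree because \<open>i < p\<close> and
    \<open>p \<le> m\<close>.\<close>
  moreover have "real D = (\<Prod>i<p. real m - real i)"
    unfolding D_def using assms(9) by (simp add: of_nat_diff)
  ultimately show ?thesis
    using \<open>D > 0\<close> by (simp add: pos_le_divide_eq mult.commute)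
qed

end
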